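(* Assume that the matrix $B_H$ has linearly independent columns, that $K\in\mathbb{R}^{n\times n}$ is symmetric, positive semi-definite, and positive definite on $V$, and that there is a constant $\nu_0>0$ independent of $n$ with $v^TKv\ge \nu_0\, v^Tv$ for all $v\in V$. For $v\in V$ write $|||v|||:=(v^TKv)^{1/2}$ and $\|v\|:=(v^Tv)^{1/2}$. Assume moreover that there are positive constants $C_0,c$ independent of $H$ such that $$\max_{w\in V_{\mathrm{ms}}\setminus\{0\}}\ \min_{v\in \tilde V_{\mathrm{ms}}}\frac{|||w-v|||}{|||w|||}\leq C_0e^{-c\rho}.$$ Then there is a constant $C$, depending only on $C_0$, $c$ and $\nu_0$ (in particular independent of $H$, $n$, $\rho$ and $F$), such that for every load vector $F\in V$ $$|||u-\tilde u_{\mathrm{ms}}|||\leq C\|F-\pi_H F\|+Ce^{-c\rho}\|F\|,$$ where $u\in V$ is the solution of $v^TKu=v^TF$ for all $v\in V$, $\tilde u_{\mathrm{ms}}\in\tilde V_{\mathrm{ms}}$ is the solution of $v^TK\tilde u_{\mathrm{ms}}=v^TF$ for all $v\in\tilde V_{\mathrm{ms}}$, and $\pi_H v=\sum_{i\in\mathcal{M}}(\lambda_i^Tv)\lambda_i$.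
   Context: Network: there are $N$ nodes in $\mathbb{R}^2$, each with $d$ degrees of freedom; $n=dN$. Degrees of freedom are numbered $1,\dots,n$ so that the $d$ degrees of freedom of node $k$ are $d(k-1)+1,\dots,dk$; $p_j\in\mathbb{R}^2$ is the position of the node carrying degree of freedom $j$. $v(j)$ denotes the $j$-th component of a vector $v$. $\mathcal{N}_D\subset\{1,\dots,n\}$ is the set of fixed degrees of freedom, $\mathcal{N}=\{1,\dots,n\}\setminus\mathcal{N}_D$, and $V=\{v\in\mathbb{R}^n: v(i)=0 \text{ for all } i\in\mathcal{N}_D\}$. "$K$ is positive definite on $V$" means $v^TKv>0$ for all nonzero $v\in V$. $K$ is the connectivity matrix of the network. Coarse grid: $\mathcal{T}$ is a finite element grid (for instance a quadrilateration) covering the computational domain, quasi-uniform with mesh size $H\approx m^{-1/2}$, with $M$ coarse nodes, $m=dM$ coarse degrees of freedom (numbered by the same convention), and nodal basis functions $\Lambda_i:\mathbb{R}^2\to\mathbb{R}$, $i=1,\dots,m$ (e.g. bilinear), where $\Lambda_i$ is the nodal basis function of the coarse node carrying degree of freedom $i$. Each coarse element contains at least one network node, and $N>M$. The set $\mathcal{M}_D\subset\{1,\dots,m\}$ of fixed coarse degrees of freedom consists of those $i$ for which there is $j\in\mathcal{N}_D$ with $\Lambda_i(p_j)\neq0$ and $i\equiv j \pmod d$; $\mathcal{M}=\{1,\dots,m\}\setminus\mathcal{M}_D$, $m_H=|\mathcal{M}|$. The vectors $\lambda_i\in\mathbb{R}^n$ are given by $\lambda_i(j)=\Lambda_i(p_j)$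 if $i\equiv j\pmod d$ and $\lambda_i(j)=0$ otherwise. $V_H=\mathrm{span}\{\lambda_i\}_{i\in\mathcal{M}}$; $B_H\in\mathbb{R}^{n\times m_H}$ is the matrix with columns $\lambda_i$, $i\in\mathcal{M}$; $C_H=B_H^T$. The detail space is $W=\{v\in V: C_Hv=0\}$ and the multiscale space is $V_{\mathrm{ms}}=\{v\in V: w^TKv=0 \text{ for all } w\in W\}$. Localization: $K=\sum_{E\in\mathcal{T}}K_E$ with element matrices $K_E\in\mathbb{R}^{n\times n}$ assembled by considering only the parts of network edges lying in the coarse element $E$ (edges crossing element boundaries are divided at the intersection points). Each element $E$ has a patch $\omega_E\subset\mathbb{R}^2$ centred at $E$ with radius $\rho H$, where $\rho>0$ is the patch size parameter. $\mathcal{N}_E\subset\mathcal{N}$ is the set of non-fixed degrees of freedom of network nodes lying in $\omega_E$, and $\tilde W_E=\{w\in W: w(i)=0 \text{ for all } i\notin\mathcal{N}_E\}$. For $i\in\mathcal{M}$, $\tilde\phi_i^E\in\tilde W_E$ is the solution of $w^TK\tilde\phi_i^E=w^TK_E\lambda_i$ for all $w\in\tilde W_E$, $\tilde\phi_i=\sum_{E\in\mathcal{T}}\tilde\phi_i^E$, and the localized multiscale space is $\tilde V_{\mathrm{ms}}=\mathrm{span}\{\lambda_i-\tilde\phi_i\}_{i\in\mathcal{M}}$. *)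

theory Defs
  imports
    "HOL-Analysis.Analysis"
    "Jordan_Normal_Form.VS_Connect"
begin

unbundle no vec_syntax and no inner_syntax

text \<open>
  Degrees of freedom, nodes and vector indices are numbered from 0, so that degree of freedom j
  belongs to node j div d, where d is the number of degrees of freedom per node. The relation
  "i and j are congruent modulo d" is unaffected by the shift from numbering from 1.
\<close>

section \<open>Networks\<close>

type_synonym point = "real^2"
type_synonym edge = "nat \<times> nat"

text \<open>
  The mechanical or physical law behind the connectivity matrix is left open: it enters through
  an arbitrary assembly rule, which turns a choice of a part of every edge into a matrix.
  Assembling whole edges gives the connectivity matrix, and assembling only the parts of the
  edges lying in a coarse element gives the matrix of that element.
\<close>

record network =
  node_count :: nat
  dofs_per_node :: nat
  node_pos :: "nat \<Rightarrow> point"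
  edges :: "edge set"
  fixed_dofs :: "nat set"
  comp_domain :: "point set"
  assemble :: "(edge \<Rightarrow> point set) \<Rightarrow> real mat"

definition dof_count :: "network \<Rightarrow> nat" where
  "dof_count G = dofs_per_node G * node_count G"

definition dof_pos :: "network \<Rightarrow> nat \<Rightarrow> point" where
  "dof_pos G j = node_pos G (j div dofs_per_node G)"

definition whole_edge :: "network \<Rightarrow> edge \<Rightarrow> point set" where
  "whole_edge G e =
     (if e \<in> edges G then closed_segment (node_pos G (fst e)) (node_pos G (snd e)) else {})"

definition is_network :: "network \<Rightarrow> bool" where
  "is_network G \<longleftrightarrow>
     dofs_per_node G > 0 \<and>
     edges G \<subseteq> {(a, b). a < node_count G \<and> b < node_count G \<and> a \<noteq> b} \<and>
     fixed_dofs G \<subseteq> {..<dof_count G} \<and>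
     (\<forall>k<node_count G. node_pos G k \<in> comp_domain G) \<and>
     (\<forall>e. whole_edge G e \<subseteq> comp_domain G) \<and>
     (\<forall>P. assemble G P \<in> carrier_mat (dof_count G) (dof_count G))"

definition free_dofs :: "network \<Rightarrow> nat set" where
  "free_dofs G = {..<dof_count G} - fixed_dofs G"

definition space_V :: "network \<Rightarrow> real vec set" where
  "space_V G = {v \<in> carrier_vec (dof_count G). \<forall>i\<in>fixed_dofs G. v $ i = 0}"

definition conn_matrix :: "network \<Rightarrow> real mat" where
  "conn_matrix G = assemble G (whole_edge G)"

definition l2_norm :: "real vec \<Rightarrow> real" where
  "l2_norm v = sqrt (v \<bullet> v)"

definition energy_norm :: "real mat \<Rightarrow> real vec \<Rightarrow> real" where
  "energy_norm K v = sqrt (v \<bullet> (K *\<^sub>v v))"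

definition symmetric_matrix :: "real mat \<Rightarrow> bool" where
  "symmetric_matrix K \<longleftrightarrow> K\<^sup>T = K"

definition pos_semidefinite :: "nat \<Rightarrow> real mat \<Rightarrow> bool" where
  "pos_semidefinite n K \<longleftrightarrow> (\<forall>v\<in>carrier_vec n. v \<bullet> (K *\<^sub>v v) \<ge> 0)"

definition pos_definite_on :: "nat \<Rightarrow> real mat \<Rightarrow> real vec set \<Rightarrow> bool" where
  "pos_definite_on n K U \<longleftrightarrow> (\<forall>v\<in>U. v \<noteq> 0\<^sub>v n \<longrightarrow> v \<bullet> (K *\<^sub>v v) > 0)"

text \<open>
  The variational problem "x in U and v^T K x = v^T b for all v in U". Its solution exists and is unique
  if U is a subspace on which K is symmetric positive definite.
\<close>

definition galerkin_solution :: "real mat \<Rightarrow> real vec set \<Rightarrow> real vec \<Rightarrow> real vec" where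
  "galerkin_solution K U b = (THE x. x \<in> U \<and> (\<forall>v\<in>U. v \<bullet> (K *\<^sub>v x) = v \<bullet> b))"

abbreviation vec_span :: "nat \<Rightarrow> real vec set \<Rightarrow> real vec set" where
  "vec_span n \<equiv> LinearCombinations.module.span class_ring (module_vec TYPE(real) n)"

abbreviation vec_lin_dep :: "nat \<Rightarrow> real vec set \<Rightarrow> bool" where
  "vec_lin_dep n \<equiv> LinearCombinations.module.lin_dep class_ring (module_vec TYPE(real) n)"

text \<open>Distinctness is needed because the set of columns forgets repetitions.\<close>

definition lin_indep_cols :: "real mat \<Rightarrow> bool" where
  "lin_indep_cols A \<longleftrightarrow> distinct (cols A) \<and> \<not> vec_lin_dep (dim_row A) (set (cols A))"


section \<open>Coarse grids\<close>

text \<open>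
  The function hat gr k is the nodal basis function of the coarse node k, and edge_part gr E e
  is the part of the network edge e that is attributed to the element E. The latter is a field
  and not simply the intersection of e with E, because an edge running along the common boundary
  of two elements must not be counted twice.
\<close>

record coarse_grid =
  elements :: "point set set"
  mesh_size :: real
  coarse_node_count :: nat
  coarse_pos :: "nat \<Rightarrow> point"
  hat :: "nat \<Rightarrow> point \<Rightarrow> real"
  edge_part :: "point set \<Rightarrow> edge \<Rightarrow> point set"

definition coarse_dof_count :: "network \<Rightarrow> coarse_grid \<Rightarrow> nat" where
  "coarse_dof_count G gr = dofs_per_node G * coarse_node_count gr"

definition elem_matrix :: "network \<Rightarrow> coarse_grid \<Rightarrow> point set \<Rightarrow> real mat" where
  "elem_matrix G gr E = assemble G (edge_part gr E)"

definition is_partition_into_elements :: "point set set \<Rightarrow> point set \<Rightarrow> bool" where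
  "is_partition_into_elements T D \<longleftrightarrow>
     finite T \<and>
     (\<forall>E\<in>T. compact E \<and> connected E \<and> interior E \<noteq> {} \<and> closure (interior E) = E) \<and>
     (\<forall>E\<in>T. \<forall>E'\<in>T. E \<noteq> E' \<longrightarrow> interior E \<inter> interior E' = {}) \<and>
     D \<subseteq> \<Union>T"

text \<open>
  The relation between H and m to the power -1/2 is understood up to the same factor
  \<open>\<kappa>\<close> that measures the quasi-uniformity.
\<close>

definition quasi_uniform :: "real \<Rightarrow> network \<Rightarrow> coarse_grid \<Rightarrow> bool" where
  "quasi_uniform \<kappa> G gr \<longleftrightarrow>
     mesh_size gr > 0 \<and>
     (\<forall>E\<in>elements gr.
        diameter E \<le> \<kappa> * mesh_size gr \<and> (\<exists>x. cball x (mesh_size gr / \<kappa>) \<subseteq> E)) \<and>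
     real (coarse_dof_count G gr) powr (- 1 / 2) / \<kappa> \<le> mesh_size gr \<and>
     mesh_size gr \<le> \<kappa> * real (coarse_dof_count G gr) powr (- 1 / 2)"

definition is_nodal_basis :: "coarse_grid \<Rightarrow> bool" where
  "is_nodal_basis gr \<longleftrightarrow>
     (\<forall>k<coarse_node_count gr.
        coarse_pos gr k \<in> \<Union>(elements gr) \<and>
        continuous_on (\<Union>(elements gr)) (hat gr k) \<and>
        (\<forall>l<coarse_node_count gr. hat gr k (coarse_pos gr l) = (if k = l then 1 else 0)) \<and>
        (\<forall>E\<in>elements gr. coarse_pos gr k \<notin> E \<longrightarrow> (\<forall>x\<in>E. hat gr k x = 0)))"

definition edges_divided :: "network \<Rightarrow> coarse_grid \<Rightarrow> bool" where
  "edges_divided G gr \<longleftrightarrow>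
     (\<forall>e. \<forall>E\<in>elements gr. edge_part gr E e \<subseteq> whole_edge G e \<inter> E) \<and>
     (\<forall>e. (\<Union>E\<in>elements gr. edge_part gr E e) = whole_edge G e) \<and>
     (\<forall>e. \<forall>E\<in>elements gr. \<forall>E'\<in>elements gr.
        E \<noteq> E' \<longrightarrow> finite (edge_part gr E e \<inter> edge_part gr E' e))"

definition is_coarse_grid :: "real \<Rightarrow> network \<Rightarrow> coarse_grid \<Rightarrow> bool" where
  "is_coarse_grid \<kappa> G gr \<longleftrightarrow>
     is_partition_into_elements (elements gr) (comp_domain G) \<and>
     quasi_uniform \<kappa> G gr \<and>
     is_nodal_basis gr \<and>
     edges_divided G gr \<and>
     (\<forall>E\<in>elements gr. \<exists>k<node_count G. node_pos G k \<in> E) \<and>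
     node_count G > coarse_node_count gr \<and>
     conn_matrix G = mat (dof_count G) (dof_count G)
       (\<lambda>(i, j). \<Sum>E\<in>elements gr. elem_matrix G gr E $$ (i, j))"


section \<open>The multiscale space\<close>

definition basis_fun :: "network \<Rightarrow> coarse_grid \<Rightarrow> nat \<Rightarrow> point \<Rightarrow> real" where
  "basis_fun G gr i = hat gr (i div dofs_per_node G)"

definition lam :: "network \<Rightarrow> coarse_grid \<Rightarrow> nat \<Rightarrow> real vec" where
  "lam G gr i = Matrix.vec (dof_count G) (\<lambda>j.
     if i mod dofs_per_node G = j mod dofs_per_node G then basis_fun G gr i (dof_pos G j) else 0)"

definition coarse_fixed_dofs :: "network \<Rightarrow> coarse_grid \<Rightarrow> nat set" where
  "coarse_fixed_dofs G gr = {i. i < coarse_dof_count G gr \<and>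
     (\<exists>j\<in>fixed_dofs G. basis_fun G gr i (dof_pos G j) \<noteq> 0 \<and>
        i mod dofs_per_node G = j mod dofs_per_node G)}"

definition coarse_free_dofs :: "network \<Rightarrow> coarse_grid \<Rightarrow> nat set" where
  "coarse_free_dofs G gr = {..<coarse_dof_count G gr} - coarse_fixed_dofs G gr"

definition B_H :: "network \<Rightarrow> coarse_grid \<Rightarrow> real mat" where
  "B_H G gr =
     mat_of_cols (dof_count G) (map (lam G gr) (sorted_list_of_set (coarse_free_dofs G gr)))"

definition C_H :: "network \<Rightarrow> coarse_grid \<Rightarrow> real mat" where
  "C_H G gr = (B_H G gr)\<^sup>T"

definition space_W :: "network \<Rightarrow> coarse_grid \<Rightarrow> real vec set" where
  "space_W G gr = {v \<in> space_V G. C_H G gr *\<^sub>v v = 0\<^sub>v (card (coarse_free_dofs G gr))}"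

definition space_Vms :: "network \<Rightarrow> coarse_grid \<Rightarrow> real vec set" where
  "space_Vms G gr = {v \<in> space_V G. \<forall>w\<in>space_W G gr. w \<bullet> (conn_matrix G *\<^sub>v v) = 0}"

text \<open>Despite its customary name, this map need not be idempotent.\<close>

definition pi_H :: "network \<Rightarrow> coarse_grid \<Rightarrow> real vec \<Rightarrow> real vec" where
  "pi_H G gr v = finsum_vec TYPE(real) (dof_count G)
     (\<lambda>i. (lam G gr i \<bullet> v) \<cdot>\<^sub>v lam G gr i) (coarse_free_dofs G gr)"


section \<open>Localization\<close>

definition patch :: "coarse_grid \<Rightarrow> real \<Rightarrow> point set \<Rightarrow> point set" where
  "patch gr \<rho> E = {x. infdist x E \<le> \<rho> * mesh_size gr}"

definition patch_dofs :: "network \<Rightarrow> coarse_grid \<Rightarrow> real \<Rightarrow> point set \<Rightarrow> nat set" where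
  "patch_dofs G gr \<rho> E = {j \<in> free_dofs G. dof_pos G j \<in> patch gr \<rho> E}"

definition space_W_loc :: "network \<Rightarrow> coarse_grid \<Rightarrow> real \<Rightarrow> point set \<Rightarrow> real vec set" where
  "space_W_loc G gr \<rho> E =
     {w \<in> space_W G gr. \<forall>i<dof_count G. i \<notin> patch_dofs G gr \<rho> E \<longrightarrow> w $ i = 0}"

definition corrector_elem ::
    "network \<Rightarrow> coarse_grid \<Rightarrow> real \<Rightarrow> nat \<Rightarrow> point set \<Rightarrow> real vec" where
  "corrector_elem G gr \<rho> i E =
     galerkin_solution (conn_matrix G) (space_W_loc G gr \<rho> E) (elem_matrix G gr E *\<^sub>v lam G gr i)"

definition corrector :: "network \<Rightarrow> coarse_grid \<Rightarrow> real \<Rightarrow> nat \<Rightarrow> real vec" where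
  "corrector G gr \<rho> i =
     finsum_vec TYPE(real) (dof_count G) (corrector_elem G gr \<rho> i) (elements gr)"

definition space_Vms_loc :: "network \<Rightarrow> coarse_grid \<Rightarrow> real \<Rightarrow> real vec set" where
  "space_Vms_loc G gr \<rho> = vec_span (dof_count G)
     ((\<lambda>i. lam G gr i - corrector G gr \<rho> i) ` coarse_free_dofs G gr)"

text \<open>
  The largest relative error of best approximation of elements of X by elements of Y. In the
  extended reals it is meaningful (namely minus infinity) also if X contains no nonzero vector.
  For subspaces X and Y of a space on which K is symmetric positive definite the extrema are attained.
\<close>

definition approx_error :: "nat \<Rightarrow> real mat \<Rightarrow> real vec set \<Rightarrow> real vec set \<Rightarrow> ereal" where
  "approx_error n K X Y =
     (SUP w\<in>X - {0\<^sub>v n}. INF v\<in>Y. ereal (energy_norm K (w - v) / energy_norm K w))"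

end

theory Submission
  imports Defs
begin

text \<open>
  Split the solution K-orthogonally as u = p + w with p in the multiscale space and w in the detail
  space. Since w is orthogonal to all coarse functions, \<open>w\<^sup>T K w = w\<^sup>T F = w\<^sup>T (F - \<pi>\<^sub>H F)\<close>, and
  coercivity bounds |||w||| by the first term of the estimate. The Galerkin solution in the
  localized space is the best approximation of u there, so its error is at most |||w||| plus the
  error of approximating p, which by hypothesis is small relative to
  \<open>|||p||| \<le> |||u||| \<le> \<parallel>F\<parallel> / sqrt \<nu>\<^sub>0\<close>. The proof gives \<open>C = (1 + C\<^sub>0) / sqrt \<nu>\<^sub>0\<close>.
\<close>


section \<open>Subspaces of coordinate space\<close>

text \<open>Taking submodules over \<open>class_ring\<close> as subspaces makes the library facts
  about spans available for \<open>space_Vms_loc\<close>.\<close>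

abbreviation vec_subspace :: "nat \<Rightarrow> real vec set \<Rightarrow> bool" where
  "vec_subspace n U \<equiv> LinearCombinations.submodule class_ring U (module_vec TYPE(real) n)"

lemma vec_subspaceI:
  assumes "U \<subseteq> carrier_vec n" "0\<^sub>v n \<in> U"
    "\<And>x y. x \<in> U \<Longrightarrow> y \<in> U \<Longrightarrow> x + y \<in> U" "\<And>r x. x \<in> U \<Longrightarrow> r \<cdot>\<^sub>v x \<in> U"
  shows "vec_subspace n U"
  using assms vec_module[where ?'a = real and n = n]
  by (auto simp: LinearCombinations.submodule_def module_vec_simps)

lemma
  assumes "vec_subspace n U"
  shows vec_subspace_carrier: "U \<subseteq> carrier_vec n"
    and vec_subspace_zero: "0\<^sub>v n \<in> U"
    and vec_subspace_add: "x \<in> U \<Longrightarrow> y \<in> U \<Longrightarrow> x + y \<in> U"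
    and vec_subspace_smult: "x \<in> U \<Longrightarrow> r \<cdot>\<^sub>v x \<in> U"
  using assms by (auto simp: LinearCombinations.submodule_def module_vec_simps class_ring_simps)

lemma vec_subspace_minus:
  assumes "vec_subspace n U" "x \<in> U" "y \<in> U"
  shows "x - y \<in> U"
proof -
  have "x - y = x + (- 1) \<cdot>\<^sub>v y"
    using vec_subspace_carrier[OF assms(1)] assms(2,3) by (intro eq_vecI) auto
  then show ?thesis
    using vec_subspace_add[OF assms(1,2)] vec_subspace_smult[OF assms(1,3)] by simp
qed

lemma finsum_vec_in_subspace:
  assumes "vec_subspace n U" "finite A" "\<And>i. i \<in> A \<Longrightarrow> f i \<in> U"
  shows "finsum_vec TYPE(real) n f A \<in> U"
  using assms(2,3)
proof (induction A rule: finite_induct)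
  case empty
  then show ?case using vec_subspace_zero[OF assms(1)] by (simp add: finsum_vec_empty)
next
  case (insert a A)
  then have "f \<in> A \<rightarrow> carrier_vec n" "f a \<in> carrier_vec n"
    using vec_subspace_carrier[OF assms(1)] by auto
  then show ?case
    using insert vec_subspace_add[OF assms(1)] by (simp add: finsum_vec_insert)
qed

lemma scalar_prod_finsum_vec:
  assumes "finite A" "w \<in> carrier_vec n" "\<And>i. i \<in> A \<Longrightarrow> f i \<in> carrier_vec n"
  shows "w \<bullet> finsum_vec TYPE(real) n f A = (\<Sum>i\<in>A. w \<bullet> f i)"
  using assms(1,3)
proof (induction A rule: finite_induct)
  case empty
  then show ?case using assms(2) by (simp add: finsum_vec_empty)
next
  case (insert a A)
  then have f: "f \<in> A \<rightarrow> carrier_vec n" "f a \<in> carrier_vec n"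
    by auto
  then show ?case
    using insert assms(2)
    by (simp add: finsum_vec_insert scalar_prod_add_distrib[of _ n] finsum_vec_closed)
qed

lemma vec_subspace_span:
  assumes "S \<subseteq> carrier_vec n"
  shows "vec_subspace n (vec_span n S)"
proof -
  interpret vec_space "TYPE(real)" n .
  show ?thesis using span_is_submodule assms by simp
qed

lemma vec_span_subset:
  assumes "vec_subspace n U" "S \<subseteq> U"
  shows "vec_span n S \<subseteq> U"
proof -
  interpret vec_space "TYPE(real)" n .
  show ?thesis using span_is_subset assms by simp
qed


section \<open>Energy forms\<close>

text \<open>Definiteness is asked only on \<open>V\<close>: before degrees of freedom are fixed,
  \<open>K\<close> may be singular. Facts resting on positivity are therefore stated for members of
  \<open>V\<close>, purely bilinear ones for all of \<open>carrier_vec n\<close>.\<close>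

locale energy_form =
  fixes n :: nat and K :: "real mat" and V :: "real vec set"
  assumes K_carrier: "K \<in> carrier_mat n n"
    and K_sym: "symmetric_matrix K"
    and V_subspace: "vec_subspace n V"
    and K_pos: "pos_definite_on n K V"
begin

definition form :: "real vec \<Rightarrow> real vec \<Rightarrow> real" where
  "form x y = x \<bullet> (K *\<^sub>v y)"

lemmas V_closed =
  vec_subspace_zero[OF V_subspace] vec_subspace_add[OF V_subspace]
  vec_subspace_smult[OF V_subspace] vec_subspace_minus[OF V_subspace]

lemma V_carrier: "x \<in> V \<Longrightarrow> x \<in> carrier_vec n"
  using vec_subspace_carrier[OF V_subspace] by auto

lemma Kx_carrier [simp]: "x \<in> carrier_vec n \<Longrightarrow> K *\<^sub>v x \<in> carrier_vec n"
  using K_carrier by simp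

lemma form_commute:
  assumes "x \<in> carrier_vec n" "y \<in> carrier_vec n"
  shows "form x y = form y x"
proof -
  have "(K\<^sup>T *\<^sub>v x) \<bullet> y = form x y"
    unfolding form_def by (rule transpose_vec_mult_scalar[OF K_carrier assms(2,1)])
  moreover have "(K\<^sup>T *\<^sub>v x) \<bullet> y = form y x"
    using K_sym assms by (simp add: form_def symmetric_matrix_def comm_scalar_prod[of _ n])
  ultimately show ?thesis by simp
qed

lemma form_right:
  assumes "x \<in> carrier_vec n" "y \<in> carrier_vec n" "z \<in> carrier_vec n"
  shows "form x (y + z) = form x y + form x z"
    and "form x (y - z) = form x y - form x z"
  using assms
  by (simp_all add: form_def mult_add_distrib_mat_vec[OF K_carrier] scalar_prod_add_distrib[of _ n]
      mult_minus_distrib_mat_vec[OF K_carrier] scalar_prod_minus_distrib[of _ n])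

lemma form_smult_right:
  assumes "x \<in> carrier_vec n" "y \<in> carrier_vec n"
  shows "form x (r \<cdot>\<^sub>v y) = r * form x y"
  using assms by (simp add: form_def mult_mat_vec[OF K_carrier])

lemma form_left:
  assumes "x \<in> carrier_vec n" "y \<in> carrier_vec n" "z \<in> carrier_vec n"
  shows "form (y + z) x = form y x + form z x"
    and "form (y - z) x = form y x - form z x"
  using assms by (simp_all add: form_commute[of _ x] form_right)

lemma form_smult_left:
  assumes "x \<in> carrier_vec n" "y \<in> carrier_vec n"
  shows "form (r \<cdot>\<^sub>v y) x = r * form y x"
  using assms by (simp add: form_commute[of _ x] form_smult_right)

lemma form_zero:
  assumes "x \<in> carrier_vec n"
  shows "form x (0\<^sub>v n) = 0" "form (0\<^sub>v n) x = 0"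
proof -
  have "0 \<cdot>\<^sub>v 0\<^sub>v n = (0\<^sub>v n :: real vec)" by (intro eq_vecI) auto
  then show "form x (0\<^sub>v n) = 0"
    using form_smult_right[OF assms zero_carrier_vec, of 0] by simp
  then show "form (0\<^sub>v n) x = 0"
    using form_commute[OF assms zero_carrier_vec] by simp
qed

section \<open>Positivity, Cauchy-Schwarz and triangle inequality\<close>

lemma form_pos: "x \<in> V \<Longrightarrow> x \<noteq> 0\<^sub>v n \<Longrightarrow> 0 < form x x"
  using K_pos by (simp add: pos_definite_on_def form_def)

lemma form_nonneg: "x \<in> V \<Longrightarrow> 0 \<le> form x x"
  using form_pos[of x] form_zero(1)[of "0\<^sub>v n"] by (cases "x = 0\<^sub>v n") auto

lemma energy_norm_sq: "x \<in> V \<Longrightarrow> (energy_norm K x)\<^sup>2 = form x x"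
  using form_nonneg by (simp add: energy_norm_def form_def)

lemma energy_norm_nonneg: "x \<in> V \<Longrightarrow> 0 \<le> energy_norm K x"
  using form_nonneg by (simp add: energy_norm_def form_def)

lemma energy_norm_pos: "x \<in> V \<Longrightarrow> x \<noteq> 0\<^sub>v n \<Longrightarrow> 0 < energy_norm K x"
  using form_pos by (simp add: energy_norm_def form_def)

lemma energy_norm_mono: "form x x \<le> form y y \<Longrightarrow> energy_norm K x \<le> energy_norm K y"
  by (simp add: energy_norm_def form_def)

lemma form_add_self:
  assumes "x \<in> V" "y \<in> V"
  shows "form (x + y) (x + y) = form x x + 2 * form x y + form y y"
  using assms by (simp add: V_carrier form_left form_right form_commute[of y x])

lemma form_cauchy_schwarz_sq:
  assumes "x \<in> V" "y \<in> V"
  shows "(form x y)\<^sup>2 \<le> form x x * form y y"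
proof (cases "y = 0\<^sub>v n")
  case True
  then show ?thesis using assms by (simp add: form_zero V_carrier)
next
  case False
  \<comment> \<open>This \<open>t\<close> minimizes the energy of \<open>x - t y\<close>;
    nonnegativity of the minimum is the claim divided by \<open>form y y\<close>.\<close>
  define t where "t = form x y / form y y"
  have pos: "0 < form y y" using form_pos assms False by simp
  have "0 \<le> form (x - t \<cdot>\<^sub>v y) (x - t \<cdot>\<^sub>v y)"
    using assms by (intro form_nonneg V_closed)
  also have "\<dots> = form x x - 2 * t * form x y + t\<^sup>2 * form y y"
    using assms
    by (simp add: V_carrier form_left form_right form_smult_left form_smult_right
        form_commute[of y x] algebra_simps power2_eq_square)
  also have "\<dots> = form x x - (form x y)\<^sup>2 / form y y"
    using pos by (simp add: t_def field_simps power2_eq_square)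
  finally show ?thesis using pos by (simp add: field_simps)
qed

lemma form_cauchy_schwarz:
  assumes "x \<in> V" "y \<in> V"
  shows "form x y \<le> energy_norm K x * energy_norm K y"
proof (rule power2_le_imp_le)
  show "(form x y)\<^sup>2 \<le> (energy_norm K x * energy_norm K y)\<^sup>2"
    using form_cauchy_schwarz_sq[OF assms] assms by (simp add: power_mult_distrib energy_norm_sq)
  show "0 \<le> energy_norm K x * energy_norm K y"
    using assms energy_norm_nonneg by simp
qed

lemma energy_norm_triangle:
  assumes "x \<in> V" "y \<in> V"
  shows "energy_norm K (x + y) \<le> energy_norm K x + energy_norm K y"
proof (rule power2_le_imp_le)
  show "(energy_norm K (x + y))\<^sup>2 \<le> (energy_norm K x + energy_norm K y)\<^sup>2"
    using form_cauchy_schwarz[OF assms] assms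
    by (simp add: energy_norm_sq V_closed form_add_self power2_sum)
  show "0 \<le> energy_norm K x + energy_norm K y"
    using assms energy_norm_nonneg by simp
qed

section \<open>Galerkin problems: solvability, best approximation, orthogonal splitting\<close>

text \<open>
  Induction on the number of coordinates that do not vanish identically on U: the subspace U'
  of U on which one such coordinate vanishes has codimension one, and the K-orthogonal complement
  of U' in U is spanned by z minus the projection of z to U'.
\<close>

lemma galerkin_exists:
  assumes "vec_subspace n U" "U \<subseteq> V" "b \<in> carrier_vec n"
  shows "\<exists>x\<in>U. \<forall>v\<in>U. form v x = v \<bullet> b"
  using assms
\<comment> \<open>The load \<open>b\<close> is generalized because the hypothesis is used for two
  loads: \<open>K *\<^sub>v z\<close>, to project \<open>z\<close>, and \<open>b\<close>
  itself.\<close>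
proof (induction "card {i. i < n \<and> (\<exists>v\<in>U. v $ i \<noteq> 0)}" arbitrary: U b rule: less_induct)
  case less
  let ?S = "\<lambda>U. {i. i < n \<and> (\<exists>v\<in>U. v $ i \<noteq> 0)}"
  note U = vec_subspace_carrier[OF less.prems(1)] vec_subspace_zero[OF less.prems(1)]
    vec_subspace_add[OF less.prems(1)] vec_subspace_smult[OF less.prems(1)]
    vec_subspace_minus[OF less.prems(1)]
  show ?case
  proof (cases "?S U = {}")
    case True
    have "v = 0\<^sub>v n" if "v \<in> U" for v
      using True that U(1) by (intro eq_vecI) auto
    then have "form v (0\<^sub>v n) = v \<bullet> b" if "v \<in> U" for v
      using form_zero(1)[OF zero_carrier_vec] scalar_prod_left_zero[OF less.prems(3)] that by simp
    then show ?thesis by (intro bexI[of _ "0\<^sub>v n"] ballI U(2))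
  next
    case False
    \<comment> \<open>The index \<open>i\<close> is counted for \<open>U\<close>, with witness
      \<open>z\<close>, but not for \<open>U'\<close>; hence the cardinality drops.\<close>
    then obtain i z where i: "i < n" and z: "z \<in> U" "z $ i \<noteq> 0" by auto
    define U' where "U' = {v \<in> U. v $ i = 0}"
    have carr: "v \<in> carrier_vec n" if "v \<in> U" for v
      using that U(1) by auto
    have "(x + y) $ i = x $ i + y $ i" "(r \<cdot>\<^sub>v x) $ i = r * x $ i" if "x \<in> U" "y \<in> U" for x y r
      using i carr[OF that(1)] carr[OF that(2)] by auto
    then have sub: "vec_subspace n U'"
      using i U(2,3,4) carr by (intro vec_subspaceI) (auto simp: U'_def)
    have "?S U' \<subset> ?S U"
      using i z by (auto simp: U'_def)
    then have card: "card (?S U') < card (?S U)"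
      by (intro psubset_card_mono) auto
    have U'V: "U' \<subseteq> V" using less.prems(2) by (auto simp: U'_def)
    \<comment> \<open>\<open>y\<close> is the K-orthogonal projection of \<open>z\<close> to
      \<open>U'\<close>, and \<open>x\<close> below solves the original problem on
      \<open>U'\<close>. As \<open>y\<close> vanishes at \<open>i\<close> and \<open>z\<close> does
      not, \<open>q = z - y\<close> is nonzero.\<close>
    obtain y where y: "y \<in> U'" "\<forall>v\<in>U'. form v y = v \<bullet> (K *\<^sub>v z)"
      using less.hyps[OF card sub U'V Kx_carrier[OF carr[OF z(1)]]] by blast
    obtain x where x: "x \<in> U'" "\<forall>v\<in>U'. form v x = v \<bullet> b"
      using less.hyps[OF card sub U'V less.prems(3)] by blast
    have yU: "y \<in> U" "y $ i = 0" and xU: "x \<in> U" "x $ i = 0"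
      using x y by (auto simp: U'_def)
    define q where "q = z - y"
    have q: "q \<in> U" "q $ i \<noteq> 0"
      using U(5)[OF z(1) yU(1)] z yU i carr[OF yU(1)] by (auto simp: q_def)
    have orth: "form v q = 0" if "v \<in> U'" for v
    proof -
      have "form v q = form v z - form v y"
        unfolding q_def using that carr z yU(1) by (intro form_right) (auto simp: U'_def)
      then show ?thesis using y(2) that by (simp add: form_def)
    qed
    have "q \<noteq> 0\<^sub>v n" using q(2) i by (metis index_zero_vec(1))
    then have qpos: "0 < form q q"
      using form_pos[of q] q(1) less.prems(2) by blast
    \<comment> \<open>Since \<open>q\<close> is K-orthogonal to \<open>x\<close>, testing
      \<open>x + s q\<close> with \<open>q\<close> leaves \<open>s * form q q\<close>, which has to
      equal \<open>q \<bullet> b\<close>.\<close>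
    define s where "s = (q \<bullet> b) / form q q"
    have "form v (x + s \<cdot>\<^sub>v q) = v \<bullet> b" if v: "v \<in> U" for v
    proof -
      \<comment> \<open>Chosen so that \<open>v - t q\<close> vanishes at \<open>i\<close> and thus
        lies in \<open>U'\<close>; the equation is then checked on \<open>U'\<close> and on
        \<open>q\<close> separately.\<close>
      define t where "t = v $ i / q $ i"
      define v' where "v' = v - t \<cdot>\<^sub>v q"
      have v': "v' \<in> U'"
        using v q U(4,5) i carr[OF q(1)] by (simp add: U'_def v'_def t_def)
      then have v'c: "v' \<in> carrier_vec n" using carr by (auto simp: U'_def)
      have v_eq: "v = v' + t \<cdot>\<^sub>v q"
        using carr[OF v] carr[OF q(1)] by (intro eq_vecI) (auto simp: v'_def)
      have "form v (x + s \<cdot>\<^sub>v q) = v' \<bullet> b + t * form q x + t * (s * form q q)"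
        unfolding v_eq using carr[OF q(1)] carr[OF xU(1)] v'c orth[OF v'] x(2) v'
        by (simp add: form_left form_right form_smult_left form_smult_right algebra_simps)
      also have "form q x = 0"
        using orth[OF x(1)] form_commute[of q x] carr[OF q(1)] carr[OF xU(1)] by simp
      also have "s * form q q = q \<bullet> b"
        using qpos by (simp add: s_def)
      also have "v' \<bullet> b + t * 0 + t * (q \<bullet> b) = v \<bullet> b"
        unfolding v_eq using carr[OF q(1)] v'c less.prems(3)
        by (simp add: add_scalar_prod_distrib[of _ n])
      finally show ?thesis .
    qed
    moreover have "x + s \<cdot>\<^sub>v q \<in> U" using U xU q by auto
    ultimately show ?thesis by blast
  qed
qed

text \<open>Justifies the definite description: the difference of two solutions, tested with itself,
  has zero energy and so vanishes.\<close>

lemma galerkin_solution: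
  assumes "vec_subspace n U" "U \<subseteq> V" "b \<in> carrier_vec n"
  shows "galerkin_solution K U b \<in> U"
    and "\<And>v. v \<in> U \<Longrightarrow> form v (galerkin_solution K U b) = v \<bullet> b"
proof -
  have "\<exists>!x. x \<in> U \<and> (\<forall>v\<in>U. v \<bullet> (K *\<^sub>v x) = v \<bullet> b)"
  proof (rule ex_ex1I)
    show "\<exists>x. x \<in> U \<and> (\<forall>v\<in>U. v \<bullet> (K *\<^sub>v x) = v \<bullet> b)"
      using galerkin_exists[OF assms] by (auto simp: form_def)
  next
    fix x y
    assume "x \<in> U \<and> (\<forall>v\<in>U. v \<bullet> (K *\<^sub>v x) = v \<bullet> b)" "y \<in> U \<and> (\<forall>v\<in>U. v \<bullet> (K *\<^sub>v y) = v \<bullet> b)"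
    then have x: "x \<in> U" "\<forall>v\<in>U. form v x = v \<bullet> b" and y: "y \<in> U" "\<forall>v\<in>U. form v y = v \<bullet> b"
      by (auto simp: form_def)
    have d: "x - y \<in> U" using vec_subspace_minus[OF assms(1)] x y by blast
    have c: "x \<in> carrier_vec n" "y \<in> carrier_vec n" "x - y \<in> carrier_vec n"
      using vec_subspace_carrier[OF assms(1)] x y d by auto
    have "form (x - y) (x - y) = form (x - y) x - form (x - y) y"
      using c by (intro form_right)
    also have "\<dots> = 0" using x y d by simp
    finally have "x - y = 0\<^sub>v n"
      using form_pos[of "x - y"] d assms(2) by auto
    moreover have "x = y + (x - y)"
      using c by (intro eq_vecI) auto
    ultimately show "x = y" using c by simp
  qed
  from theI'[OF this] show "galerkin_solution K U b \<in> U"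
    and "\<And>v. v \<in> U \<Longrightarrow> form v (galerkin_solution K U b) = v \<bullet> b"
    by (auto simp: galerkin_solution_def form_def)
qed

text \<open>Cea's lemma with constant 1: by symmetry the Galerkin error is K-orthogonal to
  \<open>U\<close>, so Pythagoras applies.\<close>

lemma galerkin_best_approximation:
  assumes U: "vec_subspace n U" "U \<subseteq> V" and b: "b \<in> carrier_vec n" and v: "v \<in> U"
  shows "energy_norm K (galerkin_solution K V b - galerkin_solution K U b)
    \<le> energy_norm K (galerkin_solution K V b - v)"
proof -
  let ?u = "galerkin_solution K V b" and ?x = "galerkin_solution K U b"
  have u: "?u \<in> V" "\<And>v. v \<in> V \<Longrightarrow> form v ?u = v \<bullet> b"
    using galerkin_solution[OF V_subspace _ b] by auto
  have x: "?x \<in> U" "\<And>v. v \<in> U \<Longrightarrow> form v ?x = v \<bullet> b"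
    using galerkin_solution[OF U b] by auto
  define e where "e = ?u - ?x"
  define h where "h = ?x - v"
  have h: "h \<in> U" using vec_subspace_minus[OF U(1) x(1) v] by (simp add: h_def)
  have inV: "?x \<in> V" "v \<in> V" "h \<in> V" "e \<in> V"
    using h v x(1) U(2) u(1) V_closed by (auto simp: e_def)
  \<comment> \<open>Galerkin orthogonality: \<open>h\<close> is an admissible test vector in both
    problems, which have the same load.\<close>
  have "form h e = 0"
    using u(2)[OF inV(3)] x(2)[OF h] V_carrier inV u(1) by (simp add: e_def form_right)
  then have "form (e + h) (e + h) = form e e + form h h"
    using inV form_add_self[of e h] form_commute[of e h] V_carrier by simp
  moreover have "?u - v = e + h"
    using V_carrier[OF inV(1)] V_carrier[OF inV(2)] V_carrier[OF u(1)]
    by (intro eq_vecI) (auto simp: e_def h_def)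
  ultimately show ?thesis
    using form_nonneg[OF inV(3)] energy_norm_mono[of e "?u - v"] by (simp add: e_def)
qed

text \<open>The projection \<open>w\<close> of \<open>u\<close> to \<open>W\<close> is the Galerkin
  solution on \<open>W\<close> for the load \<open>K *\<^sub>v u\<close>.\<close>

lemma orthogonal_splitting:
  assumes W: "vec_subspace n W" "W \<subseteq> V" and u: "u \<in> V"
  obtains p w where "u = p + w" "w \<in> W" "p \<in> V" "\<And>v. v \<in> W \<Longrightarrow> form v p = 0"
proof -
  obtain w where w: "w \<in> W" "\<forall>v\<in>W. form v w = v \<bullet> (K *\<^sub>v u)"
    using galerkin_exists[OF W, of "K *\<^sub>v u"] V_carrier[OF u] by auto
  have wV: "w \<in> V" using w W by auto
  show thesis
  proof
    show "u = (u - w) + w"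
      using V_carrier[OF u] V_carrier[OF wV] by (intro eq_vecI) auto
    show "u - w \<in> V" using V_closed u wV by blast
    show "form v (u - w) = 0" if "v \<in> W" for v
    proof -
      have "v \<in> carrier_vec n" using that W(2) V_carrier by auto
      then have "form v (u - w) = form v u - form v w"
        using V_carrier u wV by (intro form_right) auto
      then show ?thesis using w(2) that by (simp add: form_def)
    qed
  qed (fact w)
qed

end

section \<open>The Euclidean norm\<close>

lemma scalar_prod_self_sum: "x \<bullet> x = (\<Sum>i<dim_vec x. (x $ i)\<^sup>2)" for x :: "real vec"
  by (simp add: scalar_prod_def power2_eq_square atLeast0LessThan)

lemma l2_norm_nonneg: "0 \<le> l2_norm x"
  by (simp add: l2_norm_def scalar_prod_self_sum sum_nonneg)

lemma l2_cauchy_schwarz: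
  assumes "x \<in> carrier_vec n" "y \<in> carrier_vec n"
  shows "x \<bullet> y \<le> l2_norm x * l2_norm y"
proof -
  have pos: "0 < x \<bullet> x" if x: "x \<in> carrier_vec n" "x \<noteq> 0\<^sub>v n" for x :: "real vec"
  proof -
    obtain i where "i < n" "x $ i \<noteq> 0" using x by (metis carrier_vecD eq_vecI index_zero_vec)
    then show ?thesis
      using x(1) by (auto simp: scalar_prod_self_sum intro!: sum_pos2[of _ i])
  qed
  \<comment> \<open>The dot product is the energy form of the identity matrix on the whole space, so
    its Cauchy-Schwarz inequality is inherited.\<close>
  interpret energy_form n "1\<^sub>m n" "carrier_vec n"
    by (rule energy_form.intro)
      (auto simp: symmetric_matrix_def pos_definite_on_def pos intro!: vec_subspaceI)
  show ?thesis
    using form_cauchy_schwarz[OF assms] assms by (simp add: form_def energy_norm_def l2_norm_def)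
qed

section \<open>Stability bound and abstract error estimate\<close>

context energy_form
begin

text \<open>The squared energy \<open>x \<bullet> g\<close> is at most the product of the Euclidean
  norms; coercivity turns the norm of \<open>x\<close> into its energy norm, one factor of which
  cancels. The bound serves both the full solution, with load \<open>F\<close>, and its detail part,
  with load \<open>F - P\<close>.\<close>

lemma energy_norm_le_load:
  assumes "\<nu> > 0" and coercive: "\<And>v. v \<in> V \<Longrightarrow> \<nu> * (v \<bullet> v) \<le> form v v"
    and x: "x \<in> V" "g \<in> carrier_vec n" "form x x = x \<bullet> g"
  shows "energy_norm K x \<le> l2_norm g / sqrt \<nu>"
proof (cases "energy_norm K x = 0")
  case True
  then show ?thesis using \<open>\<nu> > 0\<close> l2_norm_nonneg by simp
next
  case False
  let ?e = "energy_norm K x"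
  have pos: "0 < ?e" using False energy_norm_nonneg[OF x(1)] by simp
  have "sqrt (\<nu> * (x \<bullet> x)) \<le> ?e"
    using coercive[OF x(1)] by (simp add: energy_norm_def form_def)
  then have le: "sqrt \<nu> * l2_norm x \<le> ?e"
    by (simp add: real_sqrt_mult l2_norm_def)
  have "?e * (sqrt \<nu> * ?e) = sqrt \<nu> * (x \<bullet> g)"
    using energy_norm_sq[OF x(1)] x(3) by (simp add: power2_eq_square)
  also have "\<dots> \<le> sqrt \<nu> * (l2_norm x * l2_norm g)"
    using l2_cauchy_schwarz[OF V_carrier[OF x(1)] x(2)] \<open>\<nu> > 0\<close> by (simp add: mult_left_mono)
  also have "\<dots> \<le> ?e * l2_norm g"
    using mult_right_mono[OF le l2_norm_nonneg[of g]] by (simp add: mult.assoc)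
  finally have "sqrt \<nu> * ?e \<le> l2_norm g"
    using pos by simp
  then show ?thesis using \<open>\<nu> > 0\<close> by (simp add: field_simps)
qed

text \<open>The whole estimate without the grid: \<open>P\<close> stands for
  \<open>pi_H G gr F\<close>, of which only orthogonality to \<open>W\<close> matters, and
  \<open>X\<close> for the localized space.\<close>

lemma multiscale_error:
  assumes "\<nu> > 0" and coercive: "\<And>v. v \<in> V \<Longrightarrow> \<nu> * (v \<bullet> v) \<le> form v v"
    and W: "vec_subspace n W" "W \<subseteq> V" and X: "vec_subspace n X" "X \<subseteq> V"
    and F: "F \<in> V" and P: "P \<in> carrier_vec n" "\<And>w. w \<in> W \<Longrightarrow> w \<bullet> P = 0"
    and "\<delta> \<ge> 0"
    and approx: "approx_error n K {v \<in> V. \<forall>w\<in>W. w \<bullet> (K *\<^sub>v v) = 0} X \<le> ereal \<delta>"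
  shows "energy_norm K (galerkin_solution K V F - galerkin_solution K X F)
    \<le> l2_norm (F - P) / sqrt \<nu> + \<delta> * (l2_norm F / sqrt \<nu>)"
proof -
  define u where "u = galerkin_solution K V F"
  define err where "err = energy_norm K (u - galerkin_solution K X F)"
  have Fc: "F \<in> carrier_vec n" using F V_carrier by simp
  have u: "u \<in> V" "\<And>v. v \<in> V \<Longrightarrow> form v u = v \<bullet> F"
    using galerkin_solution[OF V_subspace _ Fc] by (auto simp: u_def)
  have best: "err \<le> energy_norm K (u - v)" if "v \<in> X" for v
    using galerkin_best_approximation[OF X Fc that] by (simp add: err_def u_def)
  obtain p w where pw: "u = p + w" "w \<in> W" "p \<in> V" "\<And>v. v \<in> W \<Longrightarrow> form v p = 0"
    using orthogonal_splitting[OF W u(1)] by metis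
  have wV: "w \<in> V" using pw W by auto
  have carr: "p \<in> carrier_vec n" "w \<in> carrier_vec n" "u \<in> carrier_vec n"
    using pw wV u V_carrier by auto
  have "form w w = form w u"
    unfolding pw(1) using pw carr by (simp add: form_right)
  also have "\<dots> = w \<bullet> (F - P)"
    using u(2)[OF wV] P pw(2) carr Fc by (simp add: scalar_prod_minus_distrib[of _ n])
  finally have w_le: "energy_norm K w \<le> l2_norm (F - P) / sqrt \<nu>"
    using energy_norm_le_load[OF \<open>\<nu> > 0\<close> coercive wV] Fc P(1) by simp
  have u_le: "energy_norm K u \<le> l2_norm F / sqrt \<nu>"
    using energy_norm_le_load[OF \<open>\<nu> > 0\<close> coercive u(1) Fc u(2)] u(1) by blast
  \<comment> \<open>Pythagoras for the splitting: the energy of \<open>p\<close> is at most that of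
    \<open>u\<close>.\<close>
  have "form u u = form p p + form w w"
    unfolding pw(1) using form_add_self[OF pw(3) wV] pw(4)[OF pw(2)] form_commute carr by simp
  then have p_le: "energy_norm K p \<le> l2_norm F / sqrt \<nu>"
    using energy_norm_mono[of p u] form_nonneg[OF wV] u_le by simp
  have err_le: "err \<le> energy_norm K w + energy_norm K (p - v)" if v: "v \<in> X" for v
  proof -
    have vV: "v \<in> V" using v X by auto
    have "u - v = w + (p - v)"
      using carr V_carrier[OF vV] by (intro eq_vecI) (auto simp: pw(1))
    then show ?thesis
      using best[OF v] energy_norm_triangle[OF wV V_closed(4)[OF pw(3) vV]] by simp
  qed
  have "err \<le> energy_norm K w + \<delta> * energy_norm K p"
  \<comment> \<open>The supremum in \<open>approx_error\<close> omits the zero vector, so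
    \<open>p = 0\<close> is treated apart, with zero as the approximation from
    \<open>X\<close>.\<close>
  proof (cases "p = 0\<^sub>v n")
    case True
    then have "p - 0\<^sub>v n = p" by simp
    moreover have "energy_norm K p = 0"
      using True form_zero(1)[of "0\<^sub>v n"] by (simp add: energy_norm_def form_def)
    ultimately show ?thesis
      using err_le[OF vec_subspace_zero[OF X(1)]] by simp
  next
    case False
    have pos: "0 < energy_norm K p" using energy_norm_pos[OF pw(3) False] .
    \<comment> \<open>Since \<open>err_le\<close> holds for every \<open>v\<close> in
      \<open>X\<close>, it passes to the infimum without choosing a minimizer; the supremum is then
      bounded below by its value at \<open>p\<close>.\<close>
    have "ereal ((err - energy_norm K w) / energy_norm K p)
        \<le> (INF v\<in>X. ereal (energy_norm K (p - v) / energy_norm K p))"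
      using err_le pos by (intro INF_greatest) (auto intro!: divide_right_mono simp: algebra_simps)
    also have "\<dots> \<le> approx_error n K {v \<in> V. \<forall>w\<in>W. w \<bullet> (K *\<^sub>v v) = 0} X"
      unfolding approx_error_def using pw False by (intro SUP_upper) (auto simp: form_def)
    also note approx
    finally show ?thesis using pos by (simp add: field_simps)
  qed
  also have "\<dots> \<le> l2_norm (F - P) / sqrt \<nu> + \<delta> * (l2_norm F / sqrt \<nu>)"
    using w_le mult_left_mono[OF p_le \<open>\<delta> \<ge> 0\<close>] by simp
  finally show ?thesis by (simp add: err_def u_def)
qed

end


section \<open>The multiscale space\<close>

lemma space_V_subspace:
  assumes "is_network G"
  shows "vec_subspace (dof_count G) (space_V G)"
proof -
  \<comment> \<open>Needed for closure: the entry rules for sums and multiples of vectors apply only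
    to indices below the dimension.\<close>
  have "i < dof_count G" if "i \<in> fixed_dofs G" for i
    using assms that by (auto simp: is_network_def)
  then show ?thesis by (intro vec_subspaceI) (auto simp: space_V_def)
qed

lemma lam_carrier [simp]: "lam G gr i \<in> carrier_vec (dof_count G)"
  by (simp add: lam_def)

lemma finite_coarse_free_dofs [simp]: "finite (coarse_free_dofs G gr)"
  by (simp add: coarse_free_dofs_def)

text \<open>If \<open>lam G gr i\<close> were nonzero at a fixed degree of freedom, \<open>i\<close>
  would belong to \<open>coarse_fixed_dofs\<close> by definition.\<close>

lemma lam_in_space_V:
  assumes "is_network G" "i \<in> coarse_free_dofs G gr"
  shows "lam G gr i \<in> space_V G"
  using assms
  by (auto simp: space_V_def lam_def is_network_def coarse_free_dofs_def coarse_fixed_dofs_def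
      subset_iff)

text \<open>The rows of \<open>C_H\<close> are the coarse vectors in sorted order; this removes the
  enumeration from the constraint defining \<open>space_W\<close>.\<close>

lemma C_H_mult_eq_zero_iff:
  assumes "v \<in> carrier_vec (dof_count G)"
  shows "C_H G gr *\<^sub>v v = 0\<^sub>v (card (coarse_free_dofs G gr)) \<longleftrightarrow>
    (\<forall>i\<in>coarse_free_dofs G gr. lam G gr i \<bullet> v = 0)"
proof -
  let ?is = "sorted_list_of_set (coarse_free_dofs G gr)"
  have "row (C_H G gr) k = lam G gr (?is ! k)" if "k < length ?is" for k
    using that unfolding C_H_def B_H_def by (subst row_transpose) auto
  moreover have "dim_row (C_H G gr) = length ?is"
    by (simp add: C_H_def B_H_def)
  ultimately have "C_H G gr *\<^sub>v v = 0\<^sub>v (length ?is) \<longleftrightarrow>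
      (\<forall>k<length ?is. lam G gr (?is ! k) \<bullet> v = 0)"
    by (subst vec_eq_iff) (simp del: length_sorted_list_of_set)
  also have "\<dots> \<longleftrightarrow> (\<forall>i\<in>set ?is. lam G gr i \<bullet> v = 0)"
    by (simp only: all_set_conv_all_nth)
  finally show ?thesis by simp
qed

lemma space_W_eq:
  "space_W G gr = {v \<in> space_V G. \<forall>i\<in>coarse_free_dofs G gr. lam G gr i \<bullet> v = 0}"
  using C_H_mult_eq_zero_iff by (auto simp: space_W_def space_V_def)

lemma space_W_subspace:
  assumes "is_network G"
  shows "vec_subspace (dof_count G) (space_W G gr)"
proof -
  note V = space_V_subspace[OF assms]
  have "v \<in> carrier_vec (dof_count G)" if "v \<in> space_V G" for v
    using that by (simp add: space_V_def)
  then show ?thesis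
    using vec_subspace_zero[OF V] vec_subspace_add[OF V] vec_subspace_smult[OF V]
    by (intro vec_subspaceI)
      (auto simp: space_W_eq scalar_prod_add_distrib[of _ "dof_count G"]
        scalar_prod_smult_distrib[OF lam_carrier])
qed

lemma space_W_loc_subspace:
  assumes "is_network G"
  shows "vec_subspace (dof_count G) (space_W_loc G gr \<rho> E)"
proof -
  note W = space_W_subspace[OF assms]
  have carr: "dim_vec v = dof_count G" if "v \<in> space_W G gr" for v
    using that by (auto simp: space_W_def space_V_def)
  show ?thesis
    using vec_subspace_carrier[OF W] vec_subspace_zero[OF W] vec_subspace_add[OF W]
      vec_subspace_smult[OF W] carr
    by (intro vec_subspaceI) (auto simp: space_W_loc_def)
qed

lemma space_W_loc_subset_V: "space_W_loc G gr \<rho> E \<subseteq> space_V G"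
  by (auto simp: space_W_loc_def space_W_def)

lemma pi_H_carrier [simp]: "pi_H G gr v \<in> carrier_vec (dof_count G)"
  unfolding pi_H_def by (intro finsum_vec_closed) auto

text \<open>\<open>pi_H G gr F\<close> is a combination of the coarse vectors, each orthogonal to
  the detail space. This supplies the hypothesis on \<open>P\<close> in
  \<open>multiscale_error\<close>.\<close>

lemma space_W_orthogonal_pi_H:
  assumes "w \<in> space_W G gr"
  shows "w \<bullet> pi_H G gr F = 0"
proof -
  have w: "w \<in> carrier_vec (dof_count G)"
    using assms by (simp add: space_W_def space_V_def)
  have "w \<bullet> pi_H G gr F
      = (\<Sum>i\<in>coarse_free_dofs G gr. w \<bullet> ((lam G gr i \<bullet> F) \<cdot>\<^sub>v lam G gr i))"
    unfolding pi_H_def using w by (intro scalar_prod_finsum_vec) auto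
  also have "\<dots> = 0"
    using assms w comm_scalar_prod[OF w lam_carrier]
    by (auto simp: space_W_eq scalar_prod_smult_distrib[OF w lam_carrier] intro!: sum.neutral)
  finally show ?thesis .
qed

text \<open>The element correctors are definite descriptions, so their membership in
  \<open>space_V\<close> rests on solvability in \<open>space_W_loc\<close>; finiteness of the grid
  carries it over to their sum.\<close>

lemma space_Vms_loc_subspace:
  assumes "is_network G" "finite (elements gr)"
    and "energy_form (dof_count G) (conn_matrix G) (space_V G)"
  shows "vec_subspace (dof_count G) (space_Vms_loc G gr \<rho>)"
    and "space_Vms_loc G gr \<rho> \<subseteq> space_V G"
proof -
  note V = space_V_subspace[OF assms(1)]
  have "corrector_elem G gr \<rho> i E \<in> space_V G" for i E
  proof -
    have "elem_matrix G gr E \<in> carrier_mat (dof_count G) (dof_count G)"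
      using assms(1) by (simp add: elem_matrix_def is_network_def)
    then have "elem_matrix G gr E *\<^sub>v lam G gr i \<in> carrier_vec (dof_count G)"
      by simp
    from energy_form.galerkin_solution(1)[OF assms(3) space_W_loc_subspace[OF assms(1)]
        space_W_loc_subset_V this]
    show ?thesis
      unfolding corrector_elem_def by (rule subsetD[OF space_W_loc_subset_V])
  qed
  then have "corrector G gr \<rho> i \<in> space_V G" for i
    unfolding corrector_def using finsum_vec_in_subspace[OF V assms(2)] by blast
  then have S: "(\<lambda>i. lam G gr i - corrector G gr \<rho> i) ` coarse_free_dofs G gr \<subseteq> space_V G"
    using vec_subspace_minus[OF V] lam_in_space_V[OF assms(1)] by blast
  then show "vec_subspace (dof_count G) (space_Vms_loc G gr \<rho>)"
    unfolding space_Vms_loc_def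
    using vec_subspace_carrier[OF V] by (intro vec_subspace_span) blast
  show "space_Vms_loc G gr \<rho> \<subseteq> space_V G"
    unfolding space_Vms_loc_def using V S by (rule vec_span_subset)
qed

section \<open>The estimate with a uniform constant\<close>

theorem theorem1:
  fixes \<nu>0 C0 c :: real
  assumes "\<nu>0 > 0" and "C0 > 0" and "c > 0"
  shows "\<exists>C>0. \<forall>(G :: network) (gr :: coarse_grid) (\<kappa> :: real) (\<rho> :: real).
    is_network G \<longrightarrow>
    \<kappa> \<ge> 1 \<longrightarrow>
    is_coarse_grid \<kappa> G gr \<longrightarrow>
    \<rho> > 0 \<longrightarrow>
    lin_indep_cols (B_H G gr) \<longrightarrow>
    symmetric_matrix (conn_matrix G) \<longrightarrow>
    pos_semidefinite (dof_count G) (conn_matrix G) \<longrightarrow>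
    pos_definite_on (dof_count G) (conn_matrix G) (space_V G) \<longrightarrow>
    (\<forall>v\<in>space_V G. v \<bullet> (conn_matrix G *\<^sub>v v) \<ge> \<nu>0 * (v \<bullet> v)) \<longrightarrow>
    approx_error (dof_count G) (conn_matrix G) (space_Vms G gr) (space_Vms_loc G gr \<rho>)
      \<le> ereal (C0 * exp (- c * \<rho>)) \<longrightarrow>
    (\<forall>F\<in>space_V G.
      let u = galerkin_solution (conn_matrix G) (space_V G) F;
          u_ms = galerkin_solution (conn_matrix G) (space_Vms_loc G gr \<rho>) F
      in energy_norm (conn_matrix G) (u - u_ms)
           \<le> C * l2_norm (F - pi_H G gr F) + C * exp (- c * \<rho>) * l2_norm F)"
proof -
  \<comment> \<open>The detail part costs \<open>1 / sqrt \<nu>0\<close> and the multiscale part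
    \<open>C0 / sqrt \<nu>0\<close>; the sum dominates both and is fixed before the network and the
    grid.\<close>
  define C where "C = (1 + C0) / sqrt \<nu>0"
  have C: "C > 0" "1 / sqrt \<nu>0 \<le> C" "C0 / sqrt \<nu>0 \<le> C"
    using assms by (simp_all add: C_def divide_right_mono)
  show ?thesis
  proof (intro exI[of _ C] conjI allI impI ballI C(1))
    fix G :: network and gr :: coarse_grid and \<kappa> \<rho> :: real and F
    assume G: "is_network G" and grid: "is_coarse_grid \<kappa> G gr"
      and K: "symmetric_matrix (conn_matrix G)"
        "pos_definite_on (dof_count G) (conn_matrix G) (space_V G)"
      and coercive: "\<forall>v\<in>space_V G. v \<bullet> (conn_matrix G *\<^sub>v v) \<ge> \<nu>0 * (v \<bullet> v)"
      and approx: "approx_error (dof_count G) (conn_matrix G) (space_Vms G gr)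
        (space_Vms_loc G gr \<rho>) \<le> ereal (C0 * exp (- c * \<rho>))"
      and F: "F \<in> space_V G"
    interpret energy_form "dof_count G" "conn_matrix G" "space_V G"
      using G K space_V_subspace
      by (intro energy_form.intro) (auto simp: is_network_def conn_matrix_def)
    have fin: "finite (elements gr)"
      using grid by (simp add: is_coarse_grid_def is_partition_into_elements_def)
    note X = space_Vms_loc_subspace[OF G fin energy_form_axioms]
    have "energy_norm (conn_matrix G) (galerkin_solution (conn_matrix G) (space_V G) F -
          galerkin_solution (conn_matrix G) (space_Vms_loc G gr \<rho>) F)
        \<le> l2_norm (F - pi_H G gr F) / sqrt \<nu>0 +
          C0 * exp (- c * \<rho>) * (l2_norm F / sqrt \<nu>0)"
    \<comment> \<open>The goal determines \<open>P\<close> as \<open>pi_H G gr F\<close> and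
      \<open>\<delta>\<close> as \<open>C0 * exp (- c * \<rho>)\<close>; \<open>W\<close> occurs
      only in premises and is fixed by the first \<open>show\<close>.\<close>
    proof (rule multiscale_error)
      show "vec_subspace (dof_count G) (space_W G gr)" using space_W_subspace[OF G] .
      show "space_W G gr \<subseteq> space_V G" by (auto simp: space_W_def)
    qed (use assms coercive approx F X in
        \<open>auto simp: form_def space_Vms_def space_W_orthogonal_pi_H\<close>)
    also have "\<dots> = 1 / sqrt \<nu>0 * l2_norm (F - pi_H G gr F) +
        C0 / sqrt \<nu>0 * (exp (- c * \<rho>) * l2_norm F)"
      by simp
    also have "\<dots> \<le> C * l2_norm (F - pi_H G gr F) + C * (exp (- c * \<rho>) * l2_norm F)"
      using C by (intro add_mono mult_right_mono) (auto simp: l2_norm_nonneg)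
    finally show "let u = galerkin_solution (conn_matrix G) (space_V G) F;
        u_ms = galerkin_solution (conn_matrix G) (space_Vms_loc G gr \<rho>) F
      in energy_norm (conn_matrix G) (u - u_ms)
           \<le> C * l2_norm (F - pi_H G gr F) + C * exp (- c * \<rho>) * l2_norm F"
      by (simp add: Let_def mult.assoc)
  qed
qed

end
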